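(* Let $n$ be a positive integer and let $A$ be an $n\times n$ complex Hermitian matrix with eigenvalues $\lambda_1,\dots,\lambda_n$ (listed with multiplicity, in any order such that $\lambda_n=0$). Let $U=(u_{i,j})$ be any $n\times n$ unitary matrix such that $U^{-1}AU=\operatorname{diag}(\lambda_1,\dots,\lambda_{n-1},0)$. Let $M_n$ be the $(n-1)\times(n-1)$ submatrix of $A$ obtained by deleting its $n$th row and $n$th column, and let $\Lambda_n=\operatorname{diag}(\lambda_1,\dots,\lambda_{n-1})$. Then $$\det(M_n)=\det(\Lambda_n)\,|u_{n,n}|^2 .$$
   Context: Here $u_{n,n}$ is the $(n,n)$ entry of $U$, that is, the last component of the $n$th column of $U$, which is a unit eigenvector of $A$ for the eigenvalue $\lambda_n=0$; $|u_{n,n}|^2=u_{n,n}\overline{u_{n,n}}$. No ordering or distinctness of the eigenvalues is assumed beyond $\lambda_n=0$. For $n=1$, the determinant of the empty $0\times 0$ matrix is taken to be $1$. *)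

theory Defs
  imports "Jordan_Normal_Form.Schur_Decomposition" "Jordan_Normal_Form.Char_Poly"
begin

definition hermitian_mat :: "complex mat \<Rightarrow> bool" where
  "hermitian_mat A \<longleftrightarrow> square_mat A \<and> mat_adjoint A = A"

definition unitary_mat :: "complex mat \<Rightarrow> bool" where
  "unitary_mat U \<longleftrightarrow> square_mat U \<and> inverts_mat U (mat_adjoint U) \<and> inverts_mat (mat_adjoint U) U"

text \<open>
  The entries of a family \<open>lam\<close> with indices below \<open>n\<close> are the eigenvalues of an
  \<open>n\<close>-by-\<open>n\<close> matrix, listed with (algebraic) multiplicity. Indices start at \<open>0\<close>, as for the
  entries of a matrix; values of \<open>lam\<close> at indices from \<open>n\<close> on are irrelevant.
\<close>
definition lists_eigenvalues :: "nat \<Rightarrow> complex mat \<Rightarrow> (nat \<Rightarrow> complex) \<Rightarrow> bool" where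
  "lists_eigenvalues n A lam \<longleftrightarrow> char_poly A = (\<Prod>i<n. [:- lam i, 1:])"

end

theory Submission
  imports Defs
begin

text \<open>
  Write \<open>A = U D U\<^sup>*\<close> with \<open>D\<close> diagonal. As the last diagonal entry of \<open>D\<close> vanishes, the last
  column of \<open>U\<close> and the last row of \<open>U\<^sup>*\<close> do not contribute to \<open>A\<close>, so the leading block of \<open>A\<close>
  is the product of the leading blocks of \<open>U\<close>, \<open>D\<close> and \<open>U\<^sup>*\<close>, all of them square
  (\<open>mat_delete_mult_mat_diag_mult\<close>). Hence its determinant is \<open>det \<Lambda>\<close> times the product of the
  leading principal minors of \<open>U\<close> and of its inverse. By Cramer's rule such a minor is, up to the
  determinant of the whole matrix, the corner entry of the inverse (\<open>det_mat_delete_diag\<close>). The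
  factors \<open>det U\<close> and \<open>det U\<^sup>-\<^sup>1\<close> cancel, and what is left is the corner entry of \<open>U\<close> times that of
  \<open>U\<^sup>*\<close>, its complex conjugate.

  Up to this last step the argument concerns a matrix \<open>P D Q\<close> with mutually inverse \<open>P\<close> and \<open>Q\<close>
  over a commutative ring (\<open>det_mat_delete_similar_diag\<close>); unitarity enters only through
  \<open>U\<^sup>-\<^sup>1 = U\<^sup>*\<close>.
\<close>

text \<open>
  Both sides are the \<open>(i,i)\<close> entry of the adjugate of \<open>P\<close>, because that matrix equals
  \<open>adj P (P Q) = (adj P P) Q = det P Q\<close>. On the diagonal the cofactor carries no sign.
\<close>
lemma det_mat_delete_diag:
  fixes P Q :: "'a :: comm_ring_1 mat"
  assumes P: "P \<in> carrier_mat n n" and Q: "Q \<in> carrier_mat n n"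
    and PQ: "P * Q = 1\<^sub>m n" and i: "i < n"
  shows "det (mat_delete P i i) = det P * Q $$ (i, i)"
proof -
  note adj = adj_mat[OF P]
  have "adj_mat P = adj_mat P * (P * Q)"
    using adj(1) PQ by simp
  also have "\<dots> = (adj_mat P * P) * Q"
    using adj(1) P Q by (simp add: assoc_mult_mat)
  also have "\<dots> = det P \<cdot>\<^sub>m Q"
    using Q by (simp add: adj(3) mult_smult_assoc_mat[OF one_carrier_mat Q])
  finally have "adj_mat P $$ (i, i) = det P * Q $$ (i, i)"
    using Q i by simp
  moreover have "adj_mat P $$ (i, i) = det (mat_delete P i i)"
    using P i by (simp add: adj_mat_def cofactor_def)
  ultimately show ?thesis by simp
qed

text \<open>
  The \<open>(i,j)\<close> entry of \<open>P * mat_diag (Suc m) d * Q\<close> is the sum of the \<open>P\<^sub>i\<^sub>k d\<^sub>k Q\<^sub>k\<^sub>j\<close> over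
  \<open>k \<le> m\<close>, and the summand for \<open>k = m\<close> is zero.
\<close>
lemma mat_delete_mult_mat_diag_mult:
  fixes P Q :: "'a :: comm_ring_1 mat"
  assumes P: "P \<in> carrier_mat (Suc m) (Suc m)" and Q: "Q \<in> carrier_mat (Suc m) (Suc m)"
    and d: "d m = 0"
  shows "mat_delete (P * mat_diag (Suc m) d * Q) m m =
    mat_delete P m m * mat_diag m d * mat_delete Q m m"
proof -
  have P': "mat_delete P m m \<in> carrier_mat m m"
    using mat_delete_carrier[OF P] by simp
  show ?thesis
    unfolding mat_diag_mult_right[OF P] mat_diag_mult_right[OF P']
    using P Q d
    by (intro eq_matI) (auto simp: mat_delete_def scalar_prod_def)
qed

lemma det_mat_delete_similar_diag:
  fixes P Q :: "'a :: comm_ring_1 mat"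
  assumes P: "P \<in> carrier_mat (Suc m) (Suc m)" and Q: "Q \<in> carrier_mat (Suc m) (Suc m)"
    and PQ: "P * Q = 1\<^sub>m (Suc m)" and QP: "Q * P = 1\<^sub>m (Suc m)" and d: "d m = 0"
  shows "det (mat_delete (P * mat_diag (Suc m) d * Q) m m) =
    det (mat_diag m d) * (P $$ (m, m) * Q $$ (m, m))"
proof -
  have P': "mat_delete P m m \<in> carrier_mat m m" and Q': "mat_delete Q m m \<in> carrier_mat m m"
    using mat_delete_carrier[OF P] mat_delete_carrier[OF Q] by simp_all
  have "det P * det Q = 1"
    using det_mult[OF P Q] PQ by simp
  have "det (mat_delete (P * mat_diag (Suc m) d * Q) m m) =
      det (mat_delete P m m) * det (mat_diag m d) * det (mat_delete Q m m)"
    using P' Q' by (simp add: mat_delete_mult_mat_diag_mult[where d = d, OF P Q d] det_mult[of _ m])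
  also have "\<dots> = (det P * det Q) * (det (mat_diag m d) * (P $$ (m, m) * Q $$ (m, m)))"
    by (simp add: det_mat_delete_diag[OF P Q PQ] det_mat_delete_diag[OF Q P QP] ac_simps)
  finally show ?thesis
    using \<open>det P * det Q = 1\<close> by simp
qed

theorem theorem0p2:
  fixes n :: nat
    and A U Uinv :: "complex mat"
    and lam :: "nat \<Rightarrow> complex"
  assumes "n \<ge> 1"
    and "A \<in> carrier_mat n n" and "hermitian_mat A"
    and "lists_eigenvalues n A lam" and "lam (n - 1) = 0"
    and "U \<in> carrier_mat n n" and "unitary_mat U"
    and "Uinv \<in> carrier_mat n n" and "inverts_mat U Uinv" and "inverts_mat Uinv U"
    and "Uinv * A * U = mat_diag n lam"
  shows "det (mat_delete A (n - 1) (n - 1)) =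
    det (mat_diag (n - 1) lam) * complex_of_real ((cmod (U $$ (n - 1, n - 1)))\<^sup>2)"
proof -
  note A = assms(2) and U = assms(6) and V = assms(8)
  define m where "m = n - 1"
  have n: "n = Suc m"
    using assms(1) by (simp add: m_def)
  have UV: "U * Uinv = 1\<^sub>m n" and VU: "Uinv * U = 1\<^sub>m n"
    using assms(9,10) U V by (simp_all add: inverts_mat_def)
  have adj: "mat_adjoint U \<in> carrier_mat n n"
    using U by (auto simp: mat_adjoint_def)
  have "U * mat_adjoint U = 1\<^sub>m n"
    using assms(7) U by (simp add: unitary_mat_def inverts_mat_def)
  then have "Uinv * (U * mat_adjoint U) = Uinv"
    using V by simp
  moreover have "Uinv * (U * mat_adjoint U) = mat_adjoint U"
    using assoc_mult_mat[OF V U adj] VU adj by simp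
  ultimately have Uinv: "Uinv = mat_adjoint U" by simp
  have corner: "Uinv $$ (m, m) = cnj (U $$ (m, m))"
    using U by (simp add: Uinv mat_adjoint_def mat_of_rows_def n)
  have "U * mat_diag n lam * Uinv = U * (Uinv * A * U) * Uinv"
    using assms(11) by simp
  also have "\<dots> = (U * Uinv) * A * (U * Uinv)"
    using A U V by (simp add: assoc_mult_mat[of _ n n _ n _ n])
  finally have "U * mat_diag n lam * Uinv = A"
    using A UV by simp
  then have "det (mat_delete A m m) = det (mat_diag m lam) * (U $$ (m, m) * Uinv $$ (m, m))"
    using det_mat_delete_similar_diag[of U m Uinv lam] U V UV VU assms(5)
    by (simp add: n)
  then show ?thesis
    unfolding complex_norm_square corner m_def[symmetric] .
qed

end
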